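(* Let $\Lambda \subseteq \mathbb{R}^n$ be a lattice and let $\Vert \cdot \Vert$ be a strictly convex and smooth norm on $\mathbb{R}^n$. Then the map $v \mapsto \mathcal{V}(\Lambda, \Vert \cdot \Vert) \cap \mathcal{H}_{\Vert \cdot \Vert}^{=}(0,v)$ is a bijection from the set of Voronoi-relevant vectors of $\Lambda$ with respect to $\Vert \cdot \Vert$ to the set of facets of the Voronoi cell $\mathcal{V}(\Lambda, \Vert \cdot \Vert)$. If $n=2$, the same conclusion holds for every strictly convex norm, without assuming smoothness.
   Context: A lattice $\Lambda \subseteq \mathbb{R}^n$ is a discrete additive subgroup of $\mathbb{R}^n$; all lattices are assumed to have full rank $n$, i.e. $\Lambda$ spans $\mathbb{R}^n$ over $\mathbb{R}$. The Voronoi cell is $\mathcal{V}(\Lambda, \Vert \cdot \Vert) := \{ x \in \mathbb{R}^n \mid \forall v \in \Lambda: \Vert x \Vert \leq \Vert x-v \Vert \}$. A vector $v \in \Lambda \setminus \{0\}$ is Voronoi-relevant (with respect to $\Vert\cdot\Vert$) if there is some $x \in \mathbb{R}^n$ such that $\Vert x \Vert = \Vert x-v \Vert < \Vert x-w \Vert$ for all $w \in \Lambda \setminus \{0,v\}$. A norm is strictly convex if for all distinct $x,y \in \mathbb{R}^n$ with $\Vert x \Vert = \Vert y \Vert$ and all $\tau \in (0,1)$ we have $\Vert \tau x + (1-\tau) y \Vert < \Vert x \Vert$. A norm is smooth if each boundary point $p$ of its closed unit ball $K$ has a unique supporting hyperplane, i.e. a unique hyperplane $H$ through $p$ such that $K$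 is contained in one of the two closed halfspaces bounded by $H$. For distinct $a,b \in \mathbb{R}^n$, the bisector is $\mathcal{H}_{\Vert \cdot \Vert}^{=}(a,b) := \{ x \in \mathbb{R}^n \mid \Vert x-a \Vert = \Vert x-b \Vert \}$. For $\delta>0$, $\mathcal{B}_{\Vert \cdot \Vert_2, \delta}(x) := \{ y \in \mathbb{R}^n \mid \Vert y-x \Vert_2 < \delta \}$ is the open Euclidean ball. A facet of the Voronoi cell is a subset $\mathcal{F} \subseteq \mathcal{V}(\Lambda, \Vert \cdot \Vert)$ such that: (1) there is $v \in \Lambda \setminus \{0\}$ with $\mathcal{F} = \mathcal{V}(\Lambda, \Vert \cdot \Vert) \cap \mathcal{H}_{\Vert \cdot \Vert}^{=}(0,v)$; (2) for this $v$, there are $x \in \mathcal{F}$ and $\delta \in \mathbb{R}_{>0}$ with $\mathcal{B}_{\Vert \cdot \Vert_2, \delta}(x) \cap \mathcal{H}_{\Vert \cdot \Vert}^{=}(0,v) \subseteq \mathcal{F}$; (3) there is no $w \in \Lambda \setminus \{0\}$ such that $\mathcal{F} \subsetneqq \mathcal{V}(\Lambda, \Vert \cdot \Vert) \cap \mathcal{H}_{\Vert \cdot \Vert}^{=}(0,w)$. *)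

theory Defs
  imports "HOL-Analysis.Analysis"
begin

subsection \<open>Lattices\<close>

definition full_rank_lattice :: "'a::euclidean_space set \<Rightarrow> bool" where
  "full_rank_lattice L \<longleftrightarrow>
     0 \<in> L \<and> (\<forall>x\<in>L. \<forall>y\<in>L. x + y \<in> L) \<and> (\<forall>x\<in>L. - x \<in> L) \<and>
     discrete L \<and> span L = UNIV"

subsection \<open>Norms\<close>

text \<open>
  Arbitrary norms are functions \<open>N\<close>; the Euclidean norm remains the type-class norm,
  so \<^const>\<open>discrete\<close>, \<^const>\<open>frontier\<close> and \<^const>\<open>ball\<close> always refer to the
  Euclidean structure.
\<close>

definition is_norm :: "('a::euclidean_space \<Rightarrow> real) \<Rightarrow> bool" where
  "is_norm N \<longleftrightarrow>
     (\<forall>x. 0 \<le> N x) \<and> (\<forall>x. N x = 0 \<longleftrightarrow> x = 0) \<and>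
     (\<forall>c x. N (c *\<^sub>R x) = \<bar>c\<bar> * N x) \<and> (\<forall>x y. N (x + y) \<le> N x + N y)"

definition strictly_convex_norm :: "('a::euclidean_space \<Rightarrow> real) \<Rightarrow> bool" where
  "strictly_convex_norm N \<longleftrightarrow>
     (\<forall>x y. x \<noteq> y \<and> N x = N y \<longrightarrow>
        (\<forall>\<tau>::real. 0 < \<tau> \<and> \<tau> < 1 \<longrightarrow> N (\<tau> *\<^sub>R x + (1 - \<tau>) *\<^sub>R y) < N x))"

definition norm_unit_ball :: "('a::euclidean_space \<Rightarrow> real) \<Rightarrow> 'a set" where
  "norm_unit_ball N = {x. N x \<le> 1}"

definition supporting_hyperplane :: "'a::euclidean_space set \<Rightarrow> 'a \<Rightarrow> 'a set \<Rightarrow> bool" where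
  "supporting_hyperplane K p H \<longleftrightarrow>
     (\<exists>a b. a \<noteq> 0 \<and> H = {x. a \<bullet> x = b} \<and> p \<in> H \<and>
        (K \<subseteq> {x. a \<bullet> x \<le> b} \<or> K \<subseteq> {x. a \<bullet> x \<ge> b}))"

text \<open>
  Uniqueness is that of the hyperplane as a set, not of a normal vector
  (which is only determined up to scaling).
\<close>

definition smooth_norm :: "('a::euclidean_space \<Rightarrow> real) \<Rightarrow> bool" where
  "smooth_norm N \<longleftrightarrow>
     (\<forall>p \<in> frontier (norm_unit_ball N). \<exists>!H. supporting_hyperplane (norm_unit_ball N) p H)"

subsection \<open>Voronoi cells\<close>

definition voronoi_cell :: "'a::euclidean_space set \<Rightarrow> ('a \<Rightarrow> real) \<Rightarrow> 'a set" where
  "voronoi_cell L N = {x. \<forall>v\<in>L. N x \<le> N (x - v)}"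

definition bisector :: "('a::euclidean_space \<Rightarrow> real) \<Rightarrow> 'a \<Rightarrow> 'a \<Rightarrow> 'a set" where
  "bisector N a b = {x. N (x - a) = N (x - b)}"

definition voronoi_relevant :: "'a::euclidean_space set \<Rightarrow> ('a \<Rightarrow> real) \<Rightarrow> 'a \<Rightarrow> bool" where
  "voronoi_relevant L N v \<longleftrightarrow>
     v \<in> L - {0} \<and>
     (\<exists>x. N x = N (x - v) \<and> (\<forall>w \<in> L - {0, v}. N (x - v) < N (x - w)))"

definition voronoi_facet :: "'a::euclidean_space set \<Rightarrow> ('a \<Rightarrow> real) \<Rightarrow> 'a set \<Rightarrow> bool" where
  "voronoi_facet L N F \<longleftrightarrow>
     F \<subseteq> voronoi_cell L N \<and>
     (\<exists>v \<in> L - {0}.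
        F = voronoi_cell L N \<inter> bisector N 0 v \<and>
        (\<exists>x\<in>F. \<exists>\<delta>>0. ball x \<delta> \<inter> bisector N 0 v \<subseteq> F)) \<and>
     \<not> (\<exists>w \<in> L - {0}. F \<subset> voronoi_cell L N \<inter> bisector N 0 w)"

end

theory Submission
  imports Defs
begin

text \<open>
  A point witnessing that \<open>v\<close> is Voronoi-relevant lies in the facet of \<open>v\<close>, on no other bisector
  with the origin, and has a neighbourhood in which the cell contains the whole bisector of \<open>v\<close>;
  this gives both that relevant vectors define facets and injectivity.

  Conversely, let the cell contain a relatively open piece of the bisector of \<open>v\<close>. Only finitely
  many other bisectors meet it, so \<open>v\<close> is relevant once the bisector of \<open>v\<close> is known to leave every
  other bisector near each common point \<open>y\<close>. Take subgradients \<open>f\<close>, \<open>g\<close>, \<open>h\<close> of the norm at \<open>y\<close>,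
  \<open>y - v\<close>, \<open>y - w\<close>. By strict convexity they are never collinear. If the bisectors of \<open>v\<close> and \<open>w\<close>
  coincided near \<open>y\<close>, then along any limit direction \<open>e\<close> of common points tending to \<open>y\<close> the
  difference quotients of the three norms agree, so some such \<open>f\<close>, \<open>g\<close>, \<open>h\<close> take the same value
  on \<open>e\<close>. In dimension 2 this makes them collinear. For a smooth norm \<open>f\<close>, \<open>g\<close>, \<open>h\<close> are unique, and
  approaching \<open>y\<close> in a direction on which \<open>f\<close> and \<open>g\<close> agree but \<open>f\<close> and \<open>h\<close> do not is a
  contradiction.
\<close>

text \<open>For a norm \<open>N\<close>, homogeneity makes this the subdifferential of
  \<open>N\<close> at \<open>p\<close>: the functionals of dual norm at most 1 that attain
  \<open>N p\<close> at \<open>p\<close>.\<close>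

definition subgradients :: "('a::euclidean_space \<Rightarrow> real) \<Rightarrow> 'a \<Rightarrow> 'a set" where
  "subgradients N p = {g. (\<forall>z. g \<bullet> z \<le> N z) \<and> g \<bullet> p = N p}"

section \<open>Discreteness of lattices and avoidance of finitely many closed sets\<close>

lemma finite_bounded_lattice_part:
  assumes "full_rank_lattice L" "bounded B"
  shows "finite (L \<inter> B)"
proof -
  have L: "0 \<in> L" "\<And>x y. x \<in> L \<Longrightarrow> y \<in> L \<Longrightarrow> x + y \<in> L" "\<And>x. x \<in> L \<Longrightarrow> - x \<in> L" "discrete L"
    using assms(1) by (auto simp: full_rank_lattice_def)
  then have "0 isolated_in L" by (simp add: discreteD)
  then obtain e where "e > 0" and e: "\<And>x. x \<in> L \<Longrightarrow> dist 0 x < e \<Longrightarrow> x = 0"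
    by (auto simp: isolated_in_dist_Ex_iff)
  \<comment> \<open>Translation carries the isolation radius at 0 to every lattice point.\<close>
  have "x = y" if "x \<in> L" "y \<in> L" "dist x y < e" for x y
    using e[of "x + - y"] L(2)[of x "- y"] L(3)[of y] that by (simp add: dist_norm norm_minus_commute)
  then have "uniform_discrete L" using \<open>e > 0\<close> unfolding uniform_discrete_def by blast
  then have "uniform_discrete (L \<inter> B)" by (rule uniform_discrete_subset) auto
  moreover have "bounded (L \<inter> B)" using assms(2) by (simp add: bounded_Int)
  ultimately show ?thesis using uniform_discrete_finite_iff by blast
qed

text \<open>Induction on \<open>W\<close>: the sets already avoided are closed, so a small enough
  move off the next one does not re-enter them.\<close>

lemma avoid_finitely_many_closed:
  fixes S :: "'a::metric_space set"
  assumes "finite W" and cl: "\<And>w. w \<in> W \<Longrightarrow> closed (H w)"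
    and escape: "\<And>w y \<delta>. w \<in> W \<Longrightarrow> y \<in> S \<Longrightarrow> y \<in> H w \<Longrightarrow> \<delta> > 0 \<Longrightarrow> \<exists>z\<in>ball y \<delta> \<inter> S. z \<notin> H w"
    and "x \<in> S" "\<delta> > 0"
  shows "\<exists>z\<in>ball x \<delta> \<inter> S. \<forall>w\<in>W. z \<notin> H w"
  using assms(1) cl escape
proof (induction W rule: finite_induct)
  case empty
  then show ?case using assms by (intro bexI[of _ x]) auto
next
  case (insert w W)
  then obtain y where y: "y \<in> ball x \<delta> \<inter> S" "\<forall>w\<in>W. y \<notin> H w" by (metis insert_iff)
  show ?case
  proof (cases "y \<in> H w")
    case False
    then show ?thesis using y by auto
  next
    case True
    have "open (ball x \<delta> - (\<Union>w\<in>W. H w))"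
      using insert.hyps insert.prems(1) by (intro open_Diff open_ball closed_UN) auto
    then obtain \<eta> where "\<eta> > 0" and \<eta>: "ball y \<eta> \<subseteq> ball x \<delta> - (\<Union>w\<in>W. H w)"
      using y by (metis DiffI IntD1 UN_E open_contains_ball)
    with insert.prems(2)[of w y \<eta>] True y obtain z where "z \<in> ball y \<eta> \<inter> S" "z \<notin> H w" by auto
    then show ?thesis using \<eta> by (intro bexI[of _ z]) auto
  qed
qed

section \<open>Norms as functions, compared with the Euclidean norm\<close>

locale norm_on_euclidean =
  fixes N :: "'a::euclidean_space \<Rightarrow> real"
  assumes norm: "is_norm N"
begin

lemma N_nonneg [simp]: "0 \<le> N x"
  and N_eq_0 [simp]: "N x = 0 \<longleftrightarrow> x = 0"
  and N_scale [simp]: "N (c *\<^sub>R x) = \<bar>c\<bar> * N x"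
  and N_triangle: "N (x + y) \<le> N x + N y"
  using norm by (auto simp: is_norm_def)

lemma N_zero [simp]: "N 0 = 0"
  by simp

lemma N_minus [simp]: "N (- x) = N x"
  using N_scale[of "-1" x] by simp

lemma N_pos: "x \<noteq> 0 \<Longrightarrow> 0 < N x"
  using N_nonneg[of x] N_eq_0[of x] by linarith

lemma N_diff_le: "\<bar>N x - N y\<bar> \<le> N (x - y)"
  using N_triangle[of "x - y" y] N_triangle[of "y - x" x] N_minus[of "x - y"] by simp

lemma N_le_norm: obtains C where "C > 0" "\<And>x. N x \<le> C * norm x"
proof
  let ?C = "1 + (\<Sum>b\<in>Basis. N b)"
  show "?C > 0" by (simp add: add_pos_nonneg sum_nonneg)
  fix x :: 'a
  have sum: "N (sum f A) \<le> (\<Sum>b\<in>A. N (f b))" if "finite A" for A :: "'a set" and f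
    using that by (induction A rule: finite_induct) (auto intro: order_trans[OF N_triangle])
  have "N x = N (\<Sum>b\<in>Basis. (x \<bullet> b) *\<^sub>R b)" by (simp add: euclidean_representation)
  also have "\<dots> \<le> (\<Sum>b\<in>Basis. \<bar>x \<bullet> b\<bar> * N b)"
    using sum[of Basis "\<lambda>b. (x \<bullet> b) *\<^sub>R b"] by simp
  also have "\<dots> \<le> (\<Sum>b\<in>Basis. norm x * N b)"
    by (intro sum_mono mult_right_mono) (auto simp: Basis_le_norm)
  also have "\<dots> = norm x * (\<Sum>b\<in>Basis. N b)" by (simp add: sum_distrib_left)
  also have "\<dots> \<le> ?C * norm x" by (simp add: algebra_simps)
  finally show "N x \<le> ?C * norm x" .
qed

lemma continuous_on_N: "continuous_on A N"
proof -
  obtain C where C: "C > 0" "\<And>x. N x \<le> C * norm x" by (rule N_le_norm) blast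
  have "C-lipschitz_on A N"
    using C N_diff_le by (intro lipschitz_onI) (auto simp: dist_norm intro: order_trans)
  then show ?thesis by (rule lipschitz_on_continuous_on)
qed

lemmas continuous_on_N' [continuous_intros] = continuous_on_compose2[OF continuous_on_N _ subset_UNIV]

lemma tendsto_N [tendsto_intros]: "(f \<longlongrightarrow> l) F \<Longrightarrow> ((\<lambda>n. N (f n)) \<longlongrightarrow> N l) F"
  using continuous_on_N[of UNIV] by (simp add: continuous_on_eq_continuous_at isCont_tendsto_compose)

lemma norm_le_N: obtains c where "c > 0" "\<And>x. c * norm x \<le> N x"
proof -
  have "sphere (0::'a) 1 \<noteq> {}" by simp
  then obtain u where u: "u \<in> sphere 0 1" "\<And>x. x \<in> sphere 0 1 \<Longrightarrow> N u \<le> N x"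
    using continuous_attains_inf[OF compact_sphere _ continuous_on_N, of 0 1] by metis
  show ?thesis
  proof
    show "N u > 0" using u(1) by (intro N_pos) auto
    fix x show "N u * norm x \<le> N x"
    proof (cases "x = 0")
      case False
      then have "N u \<le> N (inverse (norm x) *\<^sub>R x)" by (intro u(2)) simp
      then show ?thesis using False by (simp add: field_simps)
    qed simp
  qed
qed

lemma closed_bisector: "closed (bisector N a b)"
  unfolding bisector_def by (intro closed_Collect_eq continuous_intros)

lemma bounded_N_ball: "bounded {x. N x \<le> R}"
proof -
  obtain c where c: "c > 0" "\<And>x. c * norm x \<le> N x" by (rule norm_le_N) blast
  have "norm x \<le> R / c" if "N x \<le> R" for x
    using c(1) order_trans[OF c(2) that] by (simp add: field_simps)
  then show ?thesis unfolding bounded_iff by auto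
qed

lemma convex_N_less: "convex {x. N x < R}"
proof (rule convexI)
  fix x y and u v :: real
  assume *: "x \<in> {x. N x < R}" "y \<in> {x. N x < R}" "0 \<le> u" "0 \<le> v" "u + v = 1"
  have "N (u *\<^sub>R x + v *\<^sub>R y) \<le> u * N x + v * N y"
    using N_triangle[of "u *\<^sub>R x" "v *\<^sub>R y"] * by simp
  also have "\<dots> < R" using * convex_bound_lt[of "N x" R "N y" u v] by simp
  finally show "u *\<^sub>R x + v *\<^sub>R y \<in> {x. N x < R}" by simp
qed

section \<open>Subgradients and difference quotients\<close>

text \<open>A hyperplane separating \<open>p\<close> from the open \<open>N\<close>-ball of radius
  \<open>N p\<close>, with its normal rescaled to take the value \<open>N p\<close> at
  \<open>p\<close>, is a subgradient.\<close>

lemma subgradients_nonempty: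
  assumes "p \<noteq> 0" shows "subgradients N p \<noteq> {}"
proof -
  have "0 \<in> {x. N x < N p}" using N_pos[OF assms] by simp
  then obtain a b where "a \<noteq> 0" and a: "\<And>x. N x < N p \<Longrightarrow> a \<bullet> x \<le> b" and b: "b \<le> a \<bullet> p"
    using separating_hyperplane_sets[OF convex_N_less[of "N p"], of "{p}"] by auto
  have le: "(a \<bullet> z) * N p \<le> (a \<bullet> p) * N z" if "z \<noteq> 0" for z
  \<comment> \<open>The separation speaks of norms below \<open>N p\<close> only: scale
    \<open>z\<close> to norm \<open>k * N p\<close> and let \<open>k\<close> tend to 1.\<close>
  proof (rule field_le_mult_one_interval)
    fix k :: real assume k: "0 < k" "k < 1"
    have pos: "N z > 0" "N p > 0" using that assms by (auto intro: N_pos)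
    then have "N ((k * N p / N z) *\<^sub>R z) < N p" using k by simp
    from a[OF this] b have "k * N p / N z * (a \<bullet> z) \<le> a \<bullet> p" by simp
    then show "k * (a \<bullet> z * N p) \<le> a \<bullet> p * N z" using pos by (simp add: field_simps)
  qed
  have "0 < (a \<bullet> a) * N p" using \<open>a \<noteq> 0\<close> assms by (simp add: N_pos)
  also have "\<dots> \<le> (a \<bullet> p) * N a" using le \<open>a \<noteq> 0\<close> by blast
  finally have ap: "a \<bullet> p > 0" by (rule zero_less_mult_pos2[OF _ N_pos[OF \<open>a \<noteq> 0\<close>]])
  have "(N p / (a \<bullet> p)) *\<^sub>R a \<in> subgradients N p"
  proof (unfold subgradients_def, intro CollectI conjI allI)
    fix z show "(N p / (a \<bullet> p)) *\<^sub>R a \<bullet> z \<le> N z"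
      using ap le[of z] by (cases "z = 0") (simp_all add: field_simps)
  qed (use ap in simp)
  then show ?thesis by auto
qed

lemma subgradient_le: "g \<in> subgradients N p \<Longrightarrow> g \<bullet> z \<le> N z"
  and subgradient_eq: "g \<in> subgradients N p \<Longrightarrow> g \<bullet> p = N p"
  and subgradientI: "(\<And>z. g \<bullet> z \<le> N z) \<Longrightarrow> g \<bullet> p = N p \<Longrightarrow> g \<in> subgradients N p"
  by (auto simp: subgradients_def)

lemma convex_subgradients: "convex (subgradients N p)"
proof (rule convexI)
  fix x y and u v :: real
  assume *: "x \<in> subgradients N p" "y \<in> subgradients N p" "0 \<le> u" "0 \<le> v" "u + v = 1"
  show "u *\<^sub>R x + v *\<^sub>R y \<in> subgradients N p"
  proof (rule subgradientI)
    fix z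
    have "u * (x \<bullet> z) + v * (y \<bullet> z) \<le> N z"
      using * by (intro convex_bound_le) (auto intro: subgradient_le)
    then show "(u *\<^sub>R x + v *\<^sub>R y) \<bullet> z \<le> N z" by (simp add: inner_add_left)
  next
    have "u * N p + v * N p = N p" using *(5) by (metis distrib_right mult_1)
    then show "(u *\<^sub>R x + v *\<^sub>R y) \<bullet> p = N p"
      using * by (simp add: inner_add_left subgradient_eq)
  qed
qed

lemma subgradients_bounded: obtains C where "\<And>p g. g \<in> subgradients N p \<Longrightarrow> norm g \<le> C"
proof -
  obtain C where C: "C > 0" "\<And>x. N x \<le> C * norm x" by (rule N_le_norm) blast
  have "norm g \<le> C" if "g \<in> subgradients N p" for g p
  proof (cases "g = 0")
    case False
    have "norm g * norm g \<le> C * norm g"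
      using order_trans[OF subgradient_le[OF that, of g] C(2)]
      by (simp add: dot_square_norm power2_eq_square)
    then show ?thesis using False by simp
  qed (use C in simp)
  then show ?thesis by (rule that)
qed

lemma subgradients_closed_graph:
  assumes "p \<longlonglongrightarrow> p0" "g \<longlonglongrightarrow> g0" "\<And>n. g n \<in> subgradients N (p n)"
  shows "g0 \<in> subgradients N p0"
proof (rule subgradientI)
  fix z
  have "(\<lambda>n. g n \<bullet> z) \<longlonglongrightarrow> g0 \<bullet> z" by (intro tendsto_intros assms)
  then show "g0 \<bullet> z \<le> N z" using assms(3) by (intro LIMSEQ_le_const2) (auto intro: subgradient_le)
next
  have "(\<lambda>n. g n \<bullet> p n) \<longlonglongrightarrow> g0 \<bullet> p0" "(\<lambda>n. N (p n)) \<longlonglongrightarrow> N p0" by (intro tendsto_intros assms)+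
  moreover have "(\<lambda>n. g n \<bullet> p n) = (\<lambda>n. N (p n))" using assms(3) by (auto intro: subgradient_eq)
  ultimately show "g0 \<bullet> p0 = N p0" by (simp add: LIMSEQ_unique)
qed

text \<open>The limit \<open>t\<close> is squeezed between the values on \<open>e\<close> of two
  subgradients at \<open>p0\<close>: any one from below, and from above a limit of subgradients at
  the points \<open>p n\<close>. By convexity some subgradient takes the value \<open>t\<close>
  itself.\<close>

lemma subgradient_of_difference_quotients:
  assumes p: "p \<longlonglongrightarrow> p0" and p0: "p0 \<noteq> 0" and ne: "\<And>n. p n \<noteq> p0"
    and e: "(\<lambda>n. sgn (p n - p0)) \<longlonglongrightarrow> e"
    and t: "(\<lambda>n. (N (p n) - N p0) / norm (p n - p0)) \<longlonglongrightarrow> t"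
  shows "\<exists>g\<in>subgradients N p0. g \<bullet> e = t"
proof -
  obtain g where g: "g \<in> subgradients N p0" using subgradients_nonempty[OF p0] by auto
  have ge: "g \<bullet> e \<le> t"
  proof (rule LIMSEQ_le[OF _ t])
    show "(\<lambda>n. g \<bullet> sgn (p n - p0)) \<longlonglongrightarrow> g \<bullet> e" by (intro tendsto_intros e)
    have "g \<bullet> sgn (p n - p0) \<le> (N (p n) - N p0) / norm (p n - p0)" for n
      using subgradient_le[OF g, of "p n"] subgradient_eq[OF g] ne[of n]
      by (simp add: sgn_div_norm inner_diff_right field_simps)
    then show "\<exists>M. \<forall>n\<ge>M. g \<bullet> sgn (p n - p0) \<le> (N (p n) - N p0) / norm (p n - p0)" by blast
  qed
  \<comment> \<open>\<open>subgradients_nonempty\<close> covers nonzero points, so pass to a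
    tail.\<close>
  have "eventually (\<lambda>n. p n \<noteq> 0) sequentially"
    using p p0 by (rule tendsto_imp_eventually_ne)
  then obtain M where M: "\<And>n. n \<ge> M \<Longrightarrow> p n \<noteq> 0" by (auto simp: eventually_sequentially)
  define q where "q n = p (n + M)" for n
  have q: "q \<longlonglongrightarrow> p0" "(\<lambda>n. sgn (q n - p0)) \<longlonglongrightarrow> e"
      "(\<lambda>n. (N (q n) - N p0) / norm (q n - p0)) \<longlonglongrightarrow> t"
    unfolding q_def using LIMSEQ_ignore_initial_segment[OF p, of M]
      LIMSEQ_ignore_initial_segment[OF e, of M] LIMSEQ_ignore_initial_segment[OF t, of M]
    by auto
  have "\<exists>h. h \<in> subgradients N (q n)" for n
    using subgradients_nonempty[of "q n"] M[of "n + M"] by (auto simp: q_def)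
  then obtain h where h: "\<And>n. h n \<in> subgradients N (q n)" by metis
  obtain C where C: "\<And>p g. g \<in> subgradients N p \<Longrightarrow> norm g \<le> C"
    by (rule subgradients_bounded) blast
  have "\<forall>n. h n \<in> cball 0 C" using C[OF h] by simp
  then obtain k r where r: "strict_mono r" and k: "(h \<circ> r) \<longlonglongrightarrow> k"
    using compact_cball[of 0 C] unfolding compact_def by blast
  have qr: "(q \<circ> r) \<longlonglongrightarrow> p0" using LIMSEQ_subseq_LIMSEQ[OF q(1) r] .
  have ksub: "k \<in> subgradients N p0"
    using subgradients_closed_graph[OF qr k] h by simp
  have ke: "t \<le> k \<bullet> e"
  proof (rule LIMSEQ_le)
    show "(\<lambda>n. (N (q (r n)) - N p0) / norm (q (r n) - p0)) \<longlonglongrightarrow> t"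
      using LIMSEQ_subseq_LIMSEQ[OF q(3) r] by (simp add: o_def)
    show "(\<lambda>n. h (r n) \<bullet> sgn (q (r n) - p0)) \<longlonglongrightarrow> k \<bullet> e"
      using k LIMSEQ_subseq_LIMSEQ[OF q(2) r] by (intro tendsto_intros) (simp_all add: o_def)
    have "(N (q n) - N p0) / norm (q n - p0) \<le> h n \<bullet> sgn (q n - p0)" for n
      using subgradient_le[OF h[of n], of p0] subgradient_eq[OF h[of n]] ne[of "n + M"]
      by (simp add: sgn_div_norm inner_diff_right field_simps q_def)
    then show "\<exists>M. \<forall>n\<ge>M. (N (q (r n)) - N p0) / norm (q (r n) - p0) \<le> h (r n) \<bullet> sgn (q (r n) - p0)"
      by blast
  qed
  have "connected ((\<lambda>g. g \<bullet> e) ` subgradients N p0)"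
    by (intro connected_continuous_image convex_connected convex_subgradients continuous_intros)
  then have "t \<in> (\<lambda>g. g \<bullet> e) ` subgradients N p0"
    using g ksub ge ke by (auto intro: connectedD_interval)
  then show ?thesis by auto
qed

text \<open>On both bisectors the norms of \<open>y n\<close>, \<open>y n - v\<close> and
  \<open>y n - w\<close> coincide, so their difference quotients form one sequence. Compactness
  makes directions and quotients converge along a common subsequence.\<close>

lemma common_direction:
  assumes y: "y \<longlonglongrightarrow> y0" and ne: "\<And>n. y n \<noteq> y0" and y0: "y0 \<noteq> 0" "y0 \<noteq> v" "y0 \<noteq> w"
    and v: "\<And>n. y n \<in> bisector N 0 v" "y0 \<in> bisector N 0 v"
    and w: "\<And>n. y n \<in> bisector N 0 w" "y0 \<in> bisector N 0 w"
  shows "\<exists>e r f g h. norm e = 1 \<and> strict_mono (r :: nat \<Rightarrow> nat) \<and> (\<lambda>n. sgn (y (r n) - y0)) \<longlonglongrightarrow> e \<and>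
    f \<in> subgradients N y0 \<and> g \<in> subgradients N (y0 - v) \<and> h \<in> subgradients N (y0 - w) \<and>
    f \<bullet> e = g \<bullet> e \<and> f \<bullet> e = h \<bullet> e"
proof -
  obtain C where C: "C > 0" "\<And>x. N x \<le> C * norm x" by (rule N_le_norm) blast
  define q where "q n = (N (y n) - N y0) / norm (y n - y0)" for n
  have "\<bar>q n\<bar> \<le> C" for n
    using order_trans[OF N_diff_le C(2), of "y n" y0] ne[of n] by (simp add: q_def field_simps)
  then have mem: "\<forall>n. (sgn (y n - y0), q n) \<in> sphere 0 1 \<times> cball 0 C"
    using ne by (auto simp: norm_sgn)
  have cpt: "compact (sphere (0::'a) 1 \<times> cball (0::real) C)"
    by (intro compact_Times compact_sphere compact_cball)
  obtain l r where l: "l \<in> sphere 0 1 \<times> cball 0 C" and r: "strict_mono r"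
    and lim: "((\<lambda>n. (sgn (y n - y0), q n)) \<circ> r) \<longlonglongrightarrow> l"
    by (rule seq_compactE[OF compact_imp_seq_compact[OF cpt] mem])
  obtain e t where et: "l = (e, t)" by (cases l)
  have e: "(\<lambda>n. sgn (y (r n) - y0)) \<longlonglongrightarrow> e" and t: "(\<lambda>n. q (r n)) \<longlonglongrightarrow> t"
    using tendsto_fst[OF lim] tendsto_snd[OF lim] by (auto simp: o_def et)
  have yr: "(\<lambda>n. y (r n)) \<longlonglongrightarrow> y0" using LIMSEQ_subseq_LIMSEQ[OF y r] by (simp add: o_def)
  have *: "\<exists>g\<in>subgradients N (y0 - a). g \<bullet> e = t"
    if "y0 \<noteq> a" "\<And>n. N (y n - a) = N (y n)" "N (y0 - a) = N y0" for a
    using subgradient_of_difference_quotients[of "\<lambda>n. y (r n) - a" "y0 - a" e t] that ne e t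
      tendsto_diff[OF yr tendsto_const, of a]
    by (simp add: q_def)
  have "norm e = 1" using l et by auto
  moreover have "\<exists>f\<in>subgradients N y0. f \<bullet> e = t" using *[of 0] y0 by simp
  moreover have "\<exists>g\<in>subgradients N (y0 - v). g \<bullet> e = t"
    using *[of v] y0 v by (simp add: bisector_def)
  moreover have "\<exists>h\<in>subgradients N (y0 - w). h \<bullet> e = t"
    using *[of w] y0 w by (simp add: bisector_def)
  ultimately show ?thesis using e r by metis
qed

text \<open>A subgradient \<open>k\<close> at \<open>p\<close> yields the supporting hyperplane
  \<open>k \<bullet> x = 1\<close> at the normalized point \<open>u\<close>; the right-hand side 1
  fixes the scaling of \<open>k\<close>.\<close>

lemma smooth_subgradient_unique:
  assumes "smooth_norm N" "p \<noteq> 0" and g: "g \<in> subgradients N p" and h: "h \<in> subgradients N p"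
  shows "g = h"
proof -
  define u where "u = inverse (N p) *\<^sub>R p"
  have Np: "N p > 0" using assms by (simp add: N_pos)
  have Nu: "N u = 1" using assms(2) by (simp add: u_def)
  have "u \<notin> interior (norm_unit_ball N)"
  proof
    assume "u \<in> interior (norm_unit_ball N)"
    then obtain \<delta> where "\<delta> > 0" and \<delta>: "ball u \<delta> \<subseteq> norm_unit_ball N"
      by (auto simp: mem_interior)
    define s where "s = \<delta> / (2 * norm u)"
    have "u \<noteq> 0" using Nu by auto
    then have s: "s > 0" "s * norm u < \<delta>" using \<open>\<delta> > 0\<close> by (auto simp: s_def)
    then have "(1 + s) *\<^sub>R u \<in> ball u \<delta>" by (simp add: dist_norm algebra_simps)
    then have "N ((1 + s) *\<^sub>R u) \<le> 1" using \<delta> unfolding norm_unit_ball_def by blast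
    then show False using s Nu by simp
  qed
  then have front: "u \<in> frontier (norm_unit_ball N)"
    using Nu by (auto simp: frontier_def norm_unit_ball_def intro: subsetD[OF closure_subset])
  have gu: "k \<bullet> u = 1" if "k \<in> subgradients N p" for k
    using subgradient_eq[OF that] assms(2) by (simp add: u_def)
  have supp: "supporting_hyperplane (norm_unit_ball N) u {x. k \<bullet> x = 1}"
    if "k \<in> subgradients N p" for k
    unfolding supporting_hyperplane_def norm_unit_ball_def using gu[OF that] subgradient_le[OF that]
    by (intro exI[of _ k] exI[of _ 1]) (auto intro: order_trans)
  have "{x. g \<bullet> x = 1} = {x. h \<bullet> x = 1}"
    using assms(1) front supp[OF g] supp[OF h] unfolding smooth_norm_def by blast
  then have eq: "g \<bullet> x = 1 \<longleftrightarrow> h \<bullet> x = 1" for x by blast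
  \<comment> \<open>The tested point is \<open>z\<close> shifted along \<open>u\<close> onto the
    hyperplane of \<open>g\<close>.\<close>
  have "g \<bullet> z = h \<bullet> z" for z
    using eq[of "u + z - (g \<bullet> z) *\<^sub>R u"] gu[OF g] gu[OF h]
    by (simp add: inner_add_right inner_diff_right)
  then show ?thesis using vector_eq_rdot by blast
qed

section \<open>From relevant vectors to facets\<close>

lemma voronoi_relevant_locally_in_cell:
  assumes L: "full_rank_lattice L"
    and x: "N x = N (x - v)" "\<And>w. w \<in> L - {0, v} \<Longrightarrow> N x < N (x - w)"
  shows "\<exists>\<delta>>0. ball x \<delta> \<inter> bisector N 0 v \<subseteq> voronoi_cell L N"
proof -
  \<comment> \<open>If \<open>N y < N x + 1\<close> and \<open>N w > 2 * (N x + 1)\<close>, the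
    triangle inequality gives \<open>N y < N (y - w)\<close>; only the finitely many
    \<open>w\<close> in \<open>W\<close> constrain the neighbourhood.\<close>
  define W where "W = (L - {0, v}) \<inter> {w. N w \<le> 2 * (N x + 1)}"
  have "finite W"
    unfolding W_def
    by (rule finite_subset[OF _ finite_bounded_lattice_part[OF L bounded_N_ball]]) auto
  define U where "U = {y. N y < N x + 1} \<inter> (\<Inter>w\<in>W. {y. N y < N (y - w)})"
  have "open U" unfolding U_def using \<open>finite W\<close>
    by (intro open_Int open_INT ballI open_Collect_less continuous_intros) auto
  moreover have "x \<in> U" using x(2) by (auto simp: U_def W_def)
  ultimately obtain \<delta> where "\<delta> > 0" and \<delta>: "ball x \<delta> \<subseteq> U"
    by (auto simp: open_contains_ball)
  have "N y \<le> N (y - w)" if "y \<in> U" "N y = N (y - v)" "w \<in> L" for y w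
  proof (cases "w \<in> W \<or> w = 0 \<or> w = v")
    case True
    then show ?thesis using that by (auto simp: U_def)
  next
    case False
    then have "N w > 2 * (N x + 1)" using that by (auto simp: W_def)
    moreover have "N w \<le> N (y - w) + N y"
      using N_triangle[of "w - y" y] N_minus[of "y - w"] by simp
    ultimately show ?thesis using that(1) by (auto simp: U_def)
  qed
  then have "ball x \<delta> \<inter> bisector N 0 v \<subseteq> voronoi_cell L N"
    using \<delta> by (auto simp: bisector_def voronoi_cell_def)
  then show ?thesis using \<open>\<delta> > 0\<close> by blast
qed

lemma voronoi_relevant_witness:
  assumes "voronoi_relevant L N v"
  obtains x where "v \<in> L - {0}" "N x = N (x - v)" "\<And>w. w \<in> L - {0, v} \<Longrightarrow> N x < N (x - w)"
    "x \<in> voronoi_cell L N" "\<And>w. w \<in> L - {0} \<Longrightarrow> x \<in> bisector N 0 w \<Longrightarrow> w = v"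
proof -
  obtain x where x: "N x = N (x - v)" "\<And>w. w \<in> L - {0, v} \<Longrightarrow> N x < N (x - w)"
    using assms unfolding voronoi_relevant_def by auto
  show ?thesis
  proof (rule that[of x])
    show "v \<in> L - {0}" using assms by (simp add: voronoi_relevant_def)
    have "N x \<le> N (x - w)" if "w \<in> L" for w
      using x that by (cases "w = 0 \<or> w = v") (auto intro: less_imp_le)
    then show "x \<in> voronoi_cell L N" by (simp add: voronoi_cell_def)
    show "w = v" if "w \<in> L - {0}" "x \<in> bisector N 0 w" for w
      using x(2)[of w] that by (auto simp: bisector_def)
  qed (use x in auto)
qed

text \<open>Maximality comes from the witness: a strictly larger intersection for \<open>w\<close>
  would contain \<open>x\<close>, forcing \<open>w = v\<close>.\<close>

lemma voronoi_relevant_imp_facet: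
  assumes L: "full_rank_lattice L" and rel: "voronoi_relevant L N v"
  shows "voronoi_facet L N (voronoi_cell L N \<inter> bisector N 0 v)"
proof -
  obtain x where x: "v \<in> L - {0}" "N x = N (x - v)" "\<And>w. w \<in> L - {0, v} \<Longrightarrow> N x < N (x - w)"
    "x \<in> voronoi_cell L N" "\<And>w. w \<in> L - {0} \<Longrightarrow> x \<in> bisector N 0 w \<Longrightarrow> w = v"
    using voronoi_relevant_witness[OF rel] by metis
  have xF: "x \<in> voronoi_cell L N \<inter> bisector N 0 v" using x(2,4) by (simp add: bisector_def)
  obtain \<delta> where "\<delta> > 0" "ball x \<delta> \<inter> bisector N 0 v \<subseteq> voronoi_cell L N"
    using voronoi_relevant_locally_in_cell[OF L x(2,3)] by auto
  then have "\<exists>x\<in>voronoi_cell L N \<inter> bisector N 0 v. \<exists>\<delta>>0.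
      ball x \<delta> \<inter> bisector N 0 v \<subseteq> voronoi_cell L N \<inter> bisector N 0 v"
    using xF by blast
  then show ?thesis
    unfolding voronoi_facet_def using x(1,5) xF by blast
qed

lemma inj_on_voronoi_relevant:
  "inj_on (\<lambda>v. voronoi_cell L N \<inter> bisector N 0 v) {v. voronoi_relevant L N v}"
proof (rule inj_onI, unfold mem_Collect_eq)
  fix v w assume rel: "voronoi_relevant L N v" "voronoi_relevant L N w"
    and eq: "voronoi_cell L N \<inter> bisector N 0 v = voronoi_cell L N \<inter> bisector N 0 w"
  obtain x where "N x = N (x - v)" "x \<in> voronoi_cell L N"
    "\<And>w. w \<in> L - {0} \<Longrightarrow> x \<in> bisector N 0 w \<Longrightarrow> w = v"
    using voronoi_relevant_witness[OF rel(1)] by metis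
  moreover have "w \<in> L - {0}" using rel(2) by (simp add: voronoi_relevant_def)
  moreover from calculation have "x \<in> voronoi_cell L N \<inter> bisector N 0 v"
    by (simp add: bisector_def)
  then have "x \<in> bisector N 0 w" unfolding eq by simp
  ultimately show "v = w" by blast
qed

end

section \<open>Strict convexity and the shape of bisectors\<close>

locale strictly_convex_norm_on_euclidean = norm_on_euclidean +
  assumes strict: "strictly_convex_norm N"
begin

text \<open>Otherwise \<open>g\<close> would exceed \<open>N\<close> at the midpoint of
  \<open>p\<close> and \<open>q\<close>.\<close>

lemma subgradient_determines_point:
  assumes "N p = N q" "g \<in> subgradients N p" "g \<in> subgradients N q"
  shows "p = q"
proof (rule ccontr)
  assume "p \<noteq> q"
  then have "N ((1/2) *\<^sub>R p + (1 - 1/2) *\<^sub>R q) < N p"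
    using strict assms(1) unfolding strictly_convex_norm_def by (smt (verit) field_sum_of_halves)
  moreover have "g \<bullet> ((1/2) *\<^sub>R p + (1 - 1/2) *\<^sub>R q) = N p"
    using assms by (simp add: inner_add_right subgradient_eq)
  ultimately show False using subgradient_le[OF assms(2)] by (metis not_less)
qed

lemma subgradient_gt:
  assumes "N p = N q" "p \<noteq> q" "g \<in> subgradients N p"
  shows "g \<bullet> q < N q"
proof (rule ccontr)
  assume "\<not> g \<bullet> q < N q"
  then have "g \<in> subgradients N q"
    using subgradient_le[OF assms(3)] by (intro subgradientI antisym) auto
  then show False using subgradient_determines_point assms by blast
qed

text \<open>
  The dual unit sphere may contain segments, but a functional inside such a segment can attain its
  norm only where both endpoints do.
\<close>

lemma subgradients_not_between:
  assumes "N p = N q" "N p = N r" "p \<noteq> q" "p \<noteq> r"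
    and f: "f \<in> subgradients N p" and g: "g \<in> subgradients N q" and h: "h \<in> subgradients N r"
  shows "\<not> between (g, h) f"
proof
  assume "between (g, h) f"
  then obtain u where u: "0 \<le> u" "u \<le> 1" "f = (1 - u) *\<^sub>R g + u *\<^sub>R h"
    by (auto simp: between_mem_segment closed_segment_def)
  have "(1 - u) * (g \<bullet> p) + u * (h \<bullet> p) < N p"
    using subgradient_gt[of q p g] subgradient_gt[of r p h] assms u
    by (intro convex_bound_lt) auto
  then show False using subgradient_eq[OF f] u by (simp add: inner_add_left)
qed

text \<open>Of three collinear points one lies between the others;
  \<open>subgradients_not_between\<close> excludes each case by rotating the roles.\<close>

lemma subgradients_not_collinear:
  assumes "N p = N q" "N p = N r" "p \<noteq> q" "p \<noteq> r" "q \<noteq> r"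
    and "f \<in> subgradients N p" "g \<in> subgradients N q" "h \<in> subgradients N r"
  shows "\<not> collinear {f, g, h}"
proof -
  have "\<not> between (g, h) f" "\<not> between (h, f) g" "\<not> between (f, g) h"
    using assms by (intro subgradients_not_between[of p q r] subgradients_not_between[of q r p]
        subgradients_not_between[of r p q]; simp)+
  then show ?thesis unfolding collinear_between_cases by blast
qed

lemma subgradient_shift:
  assumes "y \<in> bisector N 0 v" "v \<noteq> 0"
  shows "f \<in> subgradients N y \<Longrightarrow> f \<bullet> v > 0" "g \<in> subgradients N (y - v) \<Longrightarrow> g \<bullet> v < 0"
proof -
  have *: "N y = N (y - v)" "y \<noteq> y - v" using assms by (auto simp: bisector_def)
  show "f \<bullet> v > 0" if f: "f \<in> subgradients N y"
    using subgradient_gt[OF * f] subgradient_eq[OF f] * by (simp add: inner_diff_right)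
  show "g \<bullet> v < 0" if g: "g \<in> subgradients N (y - v)"
    using subgradient_gt[OF *(1)[symmetric] *(2)[symmetric] g] subgradient_eq[OF g] *
    by (simp add: inner_diff_right)
qed

text \<open>Provides the sign change for \<open>bisector_curve\<close>. Moving from \<open>y\<close>
  along \<open>v\<close>, one of the two points stays on the segment between \<open>y - v\<close>
  and \<open>y\<close>, where \<open>N\<close> is at most \<open>N y\<close>; the other passes
  strictly beyond a supporting hyperplane.\<close>

lemma bisector_crossed_by_shift:
  assumes y: "y \<in> bisector N 0 v" and v: "v \<noteq> 0" and s: "0 < s" "s \<le> 1"
  shows "N (y + s *\<^sub>R v - v) < N (y + s *\<^sub>R v)" "N (y - s *\<^sub>R v) < N (y - s *\<^sub>R v - v)"
proof -
  have eq: "N (y - v) = N y" using y by (simp add: bisector_def)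
  have "y \<noteq> 0" using eq v by auto
  then have "y - v \<noteq> 0" using eq by (metis N_eq_0)
  then obtain f g where f: "f \<in> subgradients N y" and g: "g \<in> subgradients N (y - v)"
    using \<open>y \<noteq> 0\<close> subgradients_nonempty[of y] subgradients_nonempty[of "y - v"] by auto
  have cvx: "N ((1 - s) *\<^sub>R a + s *\<^sub>R b) \<le> N y" if "N a = N y" "N b = N y" for a b
  proof -
    have "N ((1 - s) *\<^sub>R a + s *\<^sub>R b) \<le> (1 - s) * N a + s * N b"
      using N_triangle[of "(1 - s) *\<^sub>R a" "s *\<^sub>R b"] s by simp
    also have "\<dots> = N y" by (simp add: that algebra_simps)
    finally show ?thesis .
  qed
  have "N (y + s *\<^sub>R v - v) \<le> N y" using cvx[of "y - v" y] eq by (simp add: algebra_simps)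
  also have "N y < f \<bullet> (y + s *\<^sub>R v)"
    using subgradient_shift(1)[OF y v f] s subgradient_eq[OF f] by (simp add: inner_add_right)
  also have "\<dots> \<le> N (y + s *\<^sub>R v)" by (rule subgradient_le[OF f])
  finally show "N (y + s *\<^sub>R v - v) < N (y + s *\<^sub>R v)" .
  have "N (y - s *\<^sub>R v) \<le> N y" using cvx[of y "y - v"] eq by (simp add: algebra_simps)
  also have "N y < g \<bullet> (y - v - s *\<^sub>R v)"
    using mult_pos_neg[OF s(1) subgradient_shift(2)[OF y v g]] subgradient_eq[OF g] eq
    by (simp add: inner_diff_right)
  also have "\<dots> \<le> N (y - v - s *\<^sub>R v)" by (rule subgradient_le[OF g])
  also have "y - v - s *\<^sub>R v = y - s *\<^sub>R v - v" by simp
  finally show "N (y - s *\<^sub>R v) < N (y - s *\<^sub>R v - v)" .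
qed

text \<open>The signs of \<open>G\<close> at \<open>s = s0\<close> and \<open>s = - s0\<close>
  persist for small \<open>t\<close>, so the intermediate value theorem finds a bisector point on
  the line through \<open>y + t *\<^sub>R d\<close> in direction \<open>v\<close>.\<close>

lemma bisector_curve:
  assumes y: "y \<in> bisector N 0 v" and v: "v \<noteq> 0" and \<eta>: "\<eta> > 0"
  shows "\<exists>t s. 0 < t \<and> t < \<eta> \<and> \<bar>s\<bar> < \<eta> \<and> y + t *\<^sub>R d + s *\<^sub>R v \<in> bisector N 0 v"
proof -
  define G where "G z = N z - N (z - v)" for z
  have contG: "continuous_on A (\<lambda>x. G (k x))" if "continuous_on A k" for A and k :: "real \<Rightarrow> 'a"
    unfolding G_def using that by (intro continuous_intros)
  define s0 where "s0 = min (\<eta> / 2) 1"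
  have s0: "0 < s0" "s0 \<le> 1" "s0 < \<eta>" using \<eta> by (auto simp: s0_def)
  define T where "T = {t. G (y + t *\<^sub>R d + s0 *\<^sub>R v) > 0} \<inter> {t. G (y + t *\<^sub>R d - s0 *\<^sub>R v) < 0}"
  have "open T"
    unfolding T_def by (intro open_Int open_Collect_less contG continuous_intros)
  moreover have "0 \<in> T"
    using bisector_crossed_by_shift[OF y v s0(1,2)] by (simp add: T_def G_def)
  ultimately obtain \<epsilon> where "\<epsilon> > 0" and \<epsilon>: "ball 0 \<epsilon> \<subseteq> T" by (auto simp: open_contains_ball)
  define t where "t = min \<epsilon> \<eta> / 2"
  have t: "0 < t" "t < \<eta>" "t < \<epsilon>" using \<open>\<epsilon> > 0\<close> \<eta> by (auto simp: t_def)
  then have "t \<in> T" using \<epsilon> by auto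
  then have "\<exists>s\<ge>- s0. s \<le> s0 \<and> G (y + t *\<^sub>R d + s *\<^sub>R v) = 0"
    using s0 by (intro IVT' contG continuous_intros) (auto simp: T_def)
  then obtain s where "- s0 \<le> s" "s \<le> s0" "G (y + t *\<^sub>R d + s *\<^sub>R v) = 0" by blast
  then show ?thesis using t s0
    by (intro exI[of _ t] exI[of _ s]) (auto simp: G_def bisector_def)
qed

section \<open>Two bisectors near a common point\<close>

lemma bisector_escape:
  assumes dim: "smooth_norm N \<or> DIM('a) = 2" and vw: "v \<noteq> 0" "w \<noteq> 0" "w \<noteq> v"
    and y0: "y0 \<in> bisector N 0 v" "y0 \<in> bisector N 0 w" and \<delta>: "\<delta> > 0"
  shows "\<exists>z\<in>ball y0 \<delta> \<inter> bisector N 0 v. z \<notin> bisector N 0 w"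
proof (rule ccontr)
  assume "\<not> ?thesis"
  then have sub: "\<And>z. z \<in> ball y0 \<delta> \<Longrightarrow> z \<in> bisector N 0 v \<Longrightarrow> z \<in> bisector N 0 w" by blast
  have eq: "N y0 = N (y0 - v)" "N y0 = N (y0 - w)" using y0 by (auto simp: bisector_def)
  then have "N y0 \<noteq> 0" using vw by auto
  then have ne: "y0 \<noteq> 0" "y0 \<noteq> v" "y0 \<noteq> w" using eq by auto
  have noncol: "\<not> collinear {f, g, h}"
    if "f \<in> subgradients N y0" "g \<in> subgradients N (y0 - v)" "h \<in> subgradients N (y0 - w)" for f g h
    by (rule subgradients_not_collinear[OF _ _ _ _ _ that]) (use eq vw in auto)
  \<comment> \<open>Follow a curve \<open>y0 + t d + s v\<close> in the bisector of \<open>v\<close> with \<open>t > 0\<close>; that \<open>d\<close> is not a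
    multiple of \<open>v\<close> keeps it away from \<open>y0\<close>.\<close>
  have key: "\<exists>e f g h. norm e = 1 \<and> e \<in> span {d, v} \<and> f \<in> subgradients N y0 \<and>
      g \<in> subgradients N (y0 - v) \<and> h \<in> subgradients N (y0 - w) \<and> f \<bullet> e = g \<bullet> e \<and> f \<bullet> e = h \<bullet> e"
    if d: "d \<notin> span {v}" for d
  proof -
    \<comment> \<open>Chosen so that \<open>t * norm d + \<bar>s\<bar> * norm v\<close> stays below
      both \<open>\<delta>\<close>, where \<open>sub\<close> applies, and
      \<open>1 / (n + 1)\<close>, which gives convergence.\<close>
    define \<eta> where "\<eta> n = min \<delta> (inverse (real (Suc n))) / (norm d + norm v)" for n
    have den: "norm d + norm v > 0" using vw by (simp add: add_nonneg_pos)
    then have "\<eta> n > 0" for n using \<delta> by (simp add: \<eta>_def)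
    from bisector_curve[OF y0(1) vw(1) this, of _ d] obtain t s where
      ts: "\<And>n. 0 < t n" "\<And>n. t n < \<eta> n" "\<And>n. \<bar>s n\<bar> < \<eta> n"
        "\<And>n. y0 + t n *\<^sub>R d + s n *\<^sub>R v \<in> bisector N 0 v" by metis
    define y where "y n = y0 + t n *\<^sub>R d + s n *\<^sub>R v" for n
    have close: "norm (y n - y0) < min \<delta> (inverse (real (Suc n)))" for n
    proof -
      have "norm (y n - y0) \<le> t n * norm d + \<bar>s n\<bar> * norm v"
        using norm_triangle_ineq[of "t n *\<^sub>R d" "s n *\<^sub>R v"] ts(1)[of n]
        by (simp add: y_def add.assoc)
      also have "\<dots> < \<eta> n * norm d + \<eta> n * norm v"
        using ts(2,3)[of n] vw by (intro add_le_less_mono mult_right_mono mult_strict_right_mono) auto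
      also have "\<dots> = \<eta> n * (norm d + norm v)" by (simp add: distrib_left)
      also have "\<dots> = min \<delta> (inverse (real (Suc n)))"
        using den unfolding \<eta>_def by (simp del: of_nat_Suc)
      finally show ?thesis .
    qed
    have "(\<lambda>n. norm (y n - y0)) \<longlonglongrightarrow> 0"
      using close
      by (intro tendsto_sandwich[OF _ _ tendsto_const LIMSEQ_inverse_real_of_nat])
        (auto intro!: always_eventually less_imp_le)
    then have lim: "y \<longlonglongrightarrow> y0" by (simp add: tendsto_norm_zero_iff LIM_zero_iff)
    have sp: "y n - y0 \<in> span {d, v}" for n
      by (simp add: y_def add.assoc span_add span_scale span_base)
    have "y n \<noteq> y0" for n
    proof
      assume "y n = y0"
      then have "t n *\<^sub>R d = - s n *\<^sub>R v" by (simp add: y_def add.assoc add_eq_0_iff2)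
      then have "d = (- s n / t n) *\<^sub>R v" using ts(1)[of n]
        by (metis divide_inverse_commute less_numeral_extra(3) scaleR_one scaleR_scaleR left_inverse)
      then show False using d by (metis span_base span_scale singletonI)
    qed
    moreover have yv: "y n \<in> bisector N 0 v" for n unfolding y_def by (rule ts(4))
    moreover have "y n \<in> bisector N 0 w" for n
      using close[of n] by (intro sub yv) (simp add: dist_norm norm_minus_commute)
    ultimately obtain e r f g h where "norm e = 1"
      and e: "(\<lambda>n. sgn (y (r n) - y0)) \<longlonglongrightarrow> e"
      and "f \<in> subgradients N y0" "g \<in> subgradients N (y0 - v)" "h \<in> subgradients N (y0 - w)"
        "f \<bullet> e = g \<bullet> e" "f \<bullet> e = h \<bullet> e"
      using common_direction[OF lim _ ne _ y0(1) _ y0(2)] by blast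
    moreover have "e \<in> span {d, v}"
      by (rule closed_sequentially[OF closed_span _ e])
        (simp add: sgn_div_norm span_scale sp)
    ultimately show ?thesis by blast
  qed
  obtain f g h where fgh: "f \<in> subgradients N y0" "g \<in> subgradients N (y0 - v)" "h \<in> subgradients N (y0 - w)"
    using subgradients_nonempty[of y0] subgradients_nonempty[of "y0 - v"]
      subgradients_nonempty[of "y0 - w"] ne by auto
  \<comment> \<open>Gram-Schmidt: \<open>d\<close> is the component of \<open>b\<close> orthogonal
    to \<open>a\<close>.\<close>
  have project: "\<exists>d. a \<bullet> d = 0 \<and> b \<bullet> d \<noteq> 0" if "\<not> collinear {0, a, b}" for a b :: 'a
  proof -
    define d where "d = b - (a \<bullet> b / (a \<bullet> a)) *\<^sub>R a"
    have "a \<noteq> 0" "d \<noteq> 0" using that by (auto simp: d_def collinear_lemma)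
    moreover have "a \<bullet> d = 0" using \<open>a \<noteq> 0\<close> by (simp add: d_def inner_diff_right)
    moreover have "b \<bullet> d = d \<bullet> d + (a \<bullet> b / (a \<bullet> a)) * (a \<bullet> d)" by (simp add: d_def algebra_simps)
    ultimately show ?thesis by (intro exI[of _ d]) simp
  qed
  have indep: "\<not> collinear {0, g - f, h - f}"
    if "f \<in> subgradients N y0" "g \<in> subgradients N (y0 - v)" "h \<in> subgradients N (y0 - w)" for f g h
    using noncol[OF that] collinear_3[of g f h] by (simp add: NO_MATCH_def insert_commute[of f g])
  show False
    using dim
  proof
    assume sm: "smooth_norm N"
    \<comment> \<open>To first order, \<open>d\<close> is tangent to the bisector of
      \<open>v\<close> and transverse to that of \<open>w\<close>.\<close>
    obtain d where d: "(g - f) \<bullet> d = 0" "(h - f) \<bullet> d \<noteq> 0" using project[OF indep[OF fgh]] by blast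
    have gfv: "(g - f) \<bullet> v < 0"
      using subgradient_shift[OF y0(1) vw(1)] fgh by (auto simp: inner_diff_left intro: less_trans)
    have "d \<notin> span {v}" using d gfv by (auto simp: span_singleton)
    then obtain e f' g' h' where e: "norm e = 1" "e \<in> span {d, v}"
        "f' \<in> subgradients N y0" "g' \<in> subgradients N (y0 - v)" "h' \<in> subgradients N (y0 - w)"
        "f' \<bullet> e = g' \<bullet> e" "f' \<bullet> e = h' \<bullet> e"
      using key by blast
    have "f' = f" "g' = g" "h' = h"
      using smooth_subgradient_unique[OF sm, of y0] smooth_subgradient_unique[OF sm, of "y0 - v"]
        smooth_subgradient_unique[OF sm, of "y0 - w"] fgh e ne by auto
    then have ge: "(g - f) \<bullet> e = 0" "(h - f) \<bullet> e = 0" using e by (auto simp: inner_diff_left)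
    \<comment> \<open>Since \<open>g - f\<close> kills \<open>e\<close> and \<open>d\<close> but not
      \<open>v\<close>, \<open>b\<close> vanishes; since \<open>h - f\<close> kills \<open>e\<close>
      but not \<open>d\<close>, so does \<open>a\<close>. This contradicts
      \<open>norm e = 1\<close>.\<close>
    obtain a b where ab: "e = a *\<^sub>R d + b *\<^sub>R v" using e(2) by (auto simp: span_insert span_singleton algebra_simps)
    have "b = 0" using ge(1) gfv d by (simp add: ab inner_add_right)
    then have "a = 0" using ge(2) d by (simp add: ab)
    then show False using \<open>b = 0\<close> e(1) ab by simp
  next
    assume two: "DIM('a) = 2"
    have "\<exists>d. d \<notin> span {v}"
    proof (rule ccontr)
      assume "\<nexists>d. d \<notin> span {v}"
      then have "dim (span {v}) = DIM('a)" by (metis UNIV_eq_I dim_UNIV)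
      then show False using two dim_le_card'[of "{v}"] by (simp add: dim_span)
    qed
    then obtain e f g h where e: "norm e = 1"
        and fgh: "f \<in> subgradients N y0" "g \<in> subgradients N (y0 - v)" "h \<in> subgradients N (y0 - w)"
        and "f \<bullet> e = g \<bullet> e" "f \<bullet> e = h \<bullet> e"
      using key by blast
    \<comment> \<open>In the plane this hyperplane is a line, so the three subgradients would be
      collinear.\<close>
    have "{f, g, h} \<subseteq> {x. e \<bullet> x = f \<bullet> e}"
      using \<open>f \<bullet> e = g \<bullet> e\<close> \<open>f \<bullet> e = h \<bullet> e\<close> by (simp add: inner_commute)
    moreover have "e \<noteq> 0" using e by auto
    ultimately have "aff_dim {f, g, h} \<le> 1"
      using two aff_dim_subset[of "{f, g, h}" "{x. e \<bullet> x = f \<bullet> e}"] by simp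
    then show False using noncol[OF fgh] by (simp add: collinear_aff_dim)
  qed
qed

section \<open>From facets to relevant vectors, and the bijection\<close>

text \<open>A point of the open piece off all other nearby bisectors is a witness: there the weak
  inequalities of the cell become strict.\<close>

lemma facet_imp_voronoi_relevant:
  assumes dim: "smooth_norm N \<or> DIM('a) = 2" and L: "full_rank_lattice L"
    and v: "v \<in> L - {0}" and x: "x \<in> bisector N 0 v" and \<delta>: "\<delta> > 0"
    and sub: "ball x \<delta> \<inter> bisector N 0 v \<subseteq> voronoi_cell L N"
  shows "voronoi_relevant L N v"
proof -
  obtain C where C: "C > 0" "\<And>x. N x \<le> C * norm x" by (rule N_le_norm) blast
  \<comment> \<open>\<open>R\<close> bounds \<open>N\<close> on \<open>ball x \<delta>\<close>, so
    lattice vectors with \<open>N w > 2 * R\<close> are strictly farther than 0 from every point of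
    that ball.\<close>
  define R where "R = N x + C * \<delta>"
  define W where "W = (L - {0, v}) \<inter> {w. N w \<le> 2 * R}"
  have "finite W"
    unfolding W_def
    by (rule finite_subset[OF _ finite_bounded_lattice_part[OF L bounded_N_ball]]) auto
  then have "\<exists>z\<in>ball x \<delta> \<inter> bisector N 0 v. \<forall>w\<in>W. z \<notin> bisector N 0 w"
  proof (rule avoid_finitely_many_closed[OF _ closed_bisector _ x \<delta>])
    fix w y and \<epsilon> :: real
    assume "w \<in> W" "y \<in> bisector N 0 v" "y \<in> bisector N 0 w" "\<epsilon> > 0"
    then show "\<exists>z\<in>ball y \<epsilon> \<inter> bisector N 0 v. z \<notin> bisector N 0 w"
      using v by (intro bisector_escape[OF dim]) (auto simp: W_def)
  qed
  then obtain z where z: "z \<in> ball x \<delta> \<inter> bisector N 0 v" "\<And>w. w \<in> W \<Longrightarrow> z \<notin> bisector N 0 w"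
    by blast
  have "N z \<le> N x + N (z - x)" using N_triangle[of x "z - x"] by simp
  also have "N (z - x) \<le> C * norm (z - x)" by (rule C)
  also have "C * norm (z - x) < C * \<delta>"
    using C(1) z(1) by (simp add: dist_norm norm_minus_commute)
  finally have zR: "N z < R" by (simp add: R_def)
  have "N z < N (z - w)" if w: "w \<in> L - {0, v}" for w
  proof (cases "w \<in> W")
    case True
    moreover have "N z \<le> N (z - w)" using sub z(1) w by (auto simp: voronoi_cell_def)
    ultimately show ?thesis using z(2)[of w] by (auto simp: bisector_def)
  next
    case False
    then have "N w > 2 * R" using w by (auto simp: W_def)
    moreover have "N w \<le> N (z - w) + N z"
      using N_triangle[of "w - z" z] N_minus[of "z - w"] by simp
    ultimately show ?thesis using zR by simp
  qed
  moreover have "N z = N (z - v)" using z(1) by (simp add: bisector_def)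
  ultimately show ?thesis unfolding voronoi_relevant_def using v by (intro conjI exI[of _ z]) auto
qed

theorem bij_betw_voronoi_relevant_facets:
  assumes "smooth_norm N \<or> DIM('a) = 2" "full_rank_lattice L"
  shows "bij_betw (\<lambda>v. voronoi_cell L N \<inter> bisector N 0 v)
           {v. voronoi_relevant L N v} {F. voronoi_facet L N F}"
proof (rule bij_betw_imageI[OF inj_on_voronoi_relevant], intro equalityI subsetI)
  fix F assume "F \<in> {F. voronoi_facet L N F}"
  then obtain v x \<delta> where v: "v \<in> L - {0}" "F = voronoi_cell L N \<inter> bisector N 0 v"
    "x \<in> F" "\<delta> > 0" "ball x \<delta> \<inter> bisector N 0 v \<subseteq> F"
    unfolding voronoi_facet_def by blast
  then have "voronoi_relevant L N v"
    using facet_imp_voronoi_relevant[OF assms v(1), of x \<delta>] by blast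
  then show "F \<in> (\<lambda>v. voronoi_cell L N \<inter> bisector N 0 v) ` {v. voronoi_relevant L N v}"
    using v(2) by blast
qed (use voronoi_relevant_imp_facet[OF assms(2)] in blast)

end

theorem theorem6:
  fixes L :: "(real ^ 'n) set" and N :: "real ^ 'n \<Rightarrow> real"
  assumes "full_rank_lattice L"
    and "is_norm N"
    and "strictly_convex_norm N"
  shows "(smooth_norm N \<longrightarrow>
            bij_betw (\<lambda>v. voronoi_cell L N \<inter> bisector N 0 v)
              {v. voronoi_relevant L N v} {F. voronoi_facet L N F}) \<and>
         (CARD('n) = 2 \<longrightarrow>
            bij_betw (\<lambda>v. voronoi_cell L N \<inter> bisector N 0 v)
              {v. voronoi_relevant L N v} {F. voronoi_facet L N F})"
proof -
  interpret strictly_convex_norm_on_euclidean N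
    using assms(2,3) by unfold_locales
  have "DIM(real ^ 'n) = CARD('n)" by simp
  then show ?thesis
    using bij_betw_voronoi_relevant_facets[OF _ assms(1)] by metis
qed

end
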